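(* Let $\{X_\sigma,\pi^\sigma_\varrho,\Sigma\}$ be a $\kappa$-complete inverse system of topological spaces, where $\kappa=\sup\{\mu(X_\sigma):\sigma\in\Sigma\}$, and let $X$ be a dense subset of the inverse limit $\varprojlim\{X_\sigma,\pi^\sigma_\varrho,\Sigma\}$. If all bonding maps $\pi^\sigma_\varrho$ are skeletal, then $\mu(X)=\kappa$.
   Context: Spaces are non-empty, and cardinal invariants take infinite values. For a space $X$ let $\mathcal T$ be the family of all non-empty open subsets of $X$ and, for an ordinal $\alpha$, let $\mathcal T^\alpha$ be the set of all sequences of length $\alpha$ of elements of $\mathcal T$. For an infinite cardinal $\kappa$, the space $X$ is called $\kappa$-favorable if there is a function $s:\bigcup\{\mathcal T^\alpha:\alpha<\kappa\}\to\mathcal T$ such that for every sequence $\{B_{\alpha+1}:\alpha<\kappa\}\subseteq\mathcal T$ with $B_1\subseteq s(\emptyset)$ and $B_{\alpha+1}\subseteq s(\{B_{\gamma+1}:\gamma<\alpha\})$ for each $\alpha<\kappa$, the union $\bigcup\{B_{\alpha+1}:\alpha<\kappa\}$ is dense in $X$. $\mu(X)$ is the least infinite cardinal $\kappa$ such that $X$ is $\kappa$-favorable. A continuous surjection $f:X\to Y$ is skeletal if for every non-empty open $U\subseteq X$ the closure of $f[U]$ has non-empty interior. A directed set $\Sigma$ is $\kappa$-complete if every chain of length $\le\kappa$ consisting of elements of $\Sigma$ has a least upper bound in $\Sigma$. An inverse system $\{X_\sigma,\pi^\sigma_\varrho,\Sigma\}$ is $\kappa$-complete if $\Sigma$ is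 $\kappa$-complete and for every chain $A\subseteq\Sigma$ with $|A|\le\kappa$ and $\sigma=\sup A\in\Sigma$ we have $X_\sigma=\varprojlim\{X_\alpha,\pi^\beta_\alpha,A\}$. All bonding maps are assumed to be (continuous) surjections.
   Formalization: The limit projections from the inverse limit to each X_σ are additionally assumed to be surjective; surjectivity of the bonding maps does not imply this, and without it the limit can be a single point while κ is uncountable, so the claim fails. *)

theory Defs
  imports "HOL-Analysis.Analysis"
begin

unbundle cardinal_syntax

section \<open>Favorable spaces and the invariant \<open>\<mu>\<close>\<close>

text \<open>
  Cardinals are cardinal orders as in the BNF cardinal library. If \<open>\<kappa>\<close> is a cardinal order,
  the elements of \<^term>\<open>Field \<kappa>\<close> stand for the ordinals below \<open>\<kappa>\<close>: the ordinal of
  \<open>\<alpha>\<close> is the order type of the initial segment \<^term>\<open>underS \<kappa> \<alpha>\<close>.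
\<close>

definition nonempty_opens :: "'a topology \<Rightarrow> 'a set set" where
  "nonempty_opens X = {U. openin X U \<and> U \<noteq> {}}"

text \<open>
  Sequences of length \<open>\<alpha>\<close> are the extensional functions on \<^term>\<open>underS \<kappa> \<alpha>\<close>, so a strategy,
  which is a function on all sequences of length below \<open>\<kappa>\<close>, is written \<open>s \<alpha> C\<close> with the length
  \<open>\<alpha>\<close> of \<open>C\<close> passed explicitly. The value \<open>B \<alpha>\<close> below is the set with index \<open>\<alpha> + 1\<close>; the
  requirement on the first set is the instance in which \<open>\<alpha>\<close> is the least element.
\<close>

definition favorable :: "'k rel \<Rightarrow> 'a topology \<Rightarrow> bool" where
  "favorable \<kappa> X \<longleftrightarrow>
     (\<exists>s :: 'k \<Rightarrow> ('k \<Rightarrow> 'a set) \<Rightarrow> 'a set.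
        (\<forall>\<alpha>\<in>Field \<kappa>. \<forall>C\<in>underS \<kappa> \<alpha> \<rightarrow>\<^sub>E nonempty_opens X. s \<alpha> C \<in> nonempty_opens X) \<and>
        (\<forall>B. (\<forall>\<alpha>\<in>Field \<kappa>. B \<alpha> \<in> nonempty_opens X \<and> B \<alpha> \<subseteq> s \<alpha> (restrict B (underS \<kappa> \<alpha>))) \<longrightarrow>
             X closure_of (\<Union>\<alpha>\<in>Field \<kappa>. B \<alpha>) = topspace X))"

text \<open>
  The least infinite \<open>\<kappa>\<close> for which \<open>X\<close> is \<open>\<kappa>\<close>-favorable, as a cardinal order on the type
  \<^typ>\<open>'a set + nat\<close>, and determined up to \<open>=o\<close>. This type is large enough to hold the minimum
  over all cardinals: a non-empty space is \<open>\<kappa>\<close>-favorable as soon as \<open>\<kappa>\<close> is infinite and bounds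
  the number of open sets, and every smaller cardinal is represented on the same type.
\<close>

definition is_mu :: "'k rel \<Rightarrow> 'a topology \<Rightarrow> bool" where
  "is_mu \<kappa> X \<longleftrightarrow> Cinfinite \<kappa> \<and> favorable \<kappa> X \<and>
     (\<forall>\<kappa>' :: 'k rel. Cinfinite \<kappa>' \<and> favorable \<kappa>' X \<longrightarrow> \<kappa> \<le>o \<kappa>')"

definition mu :: "'a topology \<Rightarrow> ('a set + nat) rel" where
  "mu X = (SOME \<kappa>. is_mu \<kappa> X)"

lemma favorable_card_of_opens:
  fixes X :: "'a topology"
  assumes "topspace X \<noteq> {}"
  shows "favorable |UNIV :: ('a set + nat) set| X"
proof -
  define t :: "'a set + nat \<Rightarrow> 'a set" where
    "t \<alpha> = (case \<alpha> of Inl U \<Rightarrow> if U \<in> nonempty_opens X then U else topspace X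
                     | Inr _ \<Rightarrow> topspace X)" for \<alpha>
  have t: "t \<alpha> \<in> nonempty_opens X" for \<alpha>
    using assms by (auto simp: t_def nonempty_opens_def split: sum.split)
  have "X closure_of (\<Union>\<alpha>. B \<alpha>) = topspace X"
    if B: "\<forall>\<alpha>. B \<alpha> \<in> nonempty_opens X \<and> B \<alpha> \<subseteq> t \<alpha>" for B
  proof -
    have "(\<Union>\<alpha>. B \<alpha>) \<inter> U \<noteq> {}" if "openin X U" "U \<noteq> {}" for U
    proof -
      have "t (Inl U) = U"
        using that by (simp add: t_def nonempty_opens_def)
      then have "B (Inl U) \<subseteq> U" "B (Inl U) \<noteq> {}"
        using B unfolding nonempty_opens_def by blast+
      then show ?thesis by blast
    qed
    then show ?thesis
      by (simp add: dense_intersects_open)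
  qed
  then show ?thesis
    unfolding favorable_def Field_card_of using t
    by (intro exI[of _ "\<lambda>\<alpha> C. t \<alpha>"]) simp
qed

lemma is_mu_mu:
  fixes X :: "'a topology"
  assumes "topspace X \<noteq> {}"
  shows "is_mu (mu X) X"
proof -
  define R :: "('a set + nat) rel set" where "R = {\<kappa>. Cinfinite \<kappa> \<and> favorable \<kappa> X}"
  have "|UNIV :: ('a set + nat) set| \<in> R"
    using favorable_card_of_opens[OF assms]
    by (simp add: R_def cinfinite_def Field_card_of card_of_card_order_on finite_Plus_UNIV_iff)
  then obtain \<kappa> where "\<kappa> \<in> R" "\<forall>\<kappa>'\<in>R. \<kappa> \<le>o \<kappa>'"
    using exists_minim_Card_order[of R] unfolding R_def by blast
  then have "is_mu \<kappa> X"
    by (auto simp: is_mu_def R_def)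
  then show ?thesis
    unfolding mu_def by (rule someI)
qed

text \<open>
  Suprema of sets of cardinals. It suffices to compare with upper bounds on the type of \<open>\<kappa>\<close>,
  since every cardinal smaller than \<open>\<kappa>\<close> is represented on that type.
\<close>

definition is_card_Sup :: "'k rel \<Rightarrow> 'c rel set \<Rightarrow> bool" where
  "is_card_Sup \<kappa> R \<longleftrightarrow> Card_order \<kappa> \<and> (\<forall>r\<in>R. r \<le>o \<kappa>) \<and>
     (\<forall>\<kappa>' :: 'k rel. Card_order \<kappa>' \<and> (\<forall>r\<in>R. r \<le>o \<kappa>') \<longrightarrow> \<kappa> \<le>o \<kappa>')"

section \<open>Skeletal maps and inverse systems\<close>

definition skeletal_map :: "'a topology \<Rightarrow> 'b topology \<Rightarrow> ('a \<Rightarrow> 'b) \<Rightarrow> bool" where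
  "skeletal_map X Y f \<longleftrightarrow>
     continuous_map X Y f \<and> f ` topspace X = topspace Y \<and>
     (\<forall>U. openin X U \<and> U \<noteq> {} \<longrightarrow> Y interior_of (Y closure_of (f ` U)) \<noteq> {})"

definition directed_set :: "'s set \<Rightarrow> ('s \<Rightarrow> 's \<Rightarrow> bool) \<Rightarrow> bool" where
  "directed_set S le \<longleftrightarrow> S \<noteq> {} \<and> reflp_on S le \<and> transp_on S le \<and>
     (\<forall>\<sigma>\<in>S. \<forall>\<tau>\<in>S. \<exists>\<upsilon>\<in>S. le \<sigma> \<upsilon> \<and> le \<tau> \<upsilon>)"

definition is_lub_in :: "'s set \<Rightarrow> ('s \<Rightarrow> 's \<Rightarrow> bool) \<Rightarrow> 's set \<Rightarrow> 's \<Rightarrow> bool" where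
  "is_lub_in S le A \<sigma> \<longleftrightarrow> \<sigma> \<in> S \<and> (\<forall>\<alpha>\<in>A. le \<alpha> \<sigma>) \<and>
     (\<forall>\<tau>\<in>S. (\<forall>\<alpha>\<in>A. le \<alpha> \<tau>) \<longrightarrow> le \<sigma> \<tau>)"

text \<open>The bonding map from \<open>X \<sigma>\<close> to \<open>X \<rho>\<close>, for \<open>le \<rho> \<sigma>\<close>, is \<open>p \<sigma> \<rho>\<close>.\<close>

definition inverse_system ::
    "'s set \<Rightarrow> ('s \<Rightarrow> 's \<Rightarrow> bool) \<Rightarrow> ('s \<Rightarrow> 'a topology) \<Rightarrow> ('s \<Rightarrow> 's \<Rightarrow> 'a \<Rightarrow> 'a) \<Rightarrow> bool" where
  "inverse_system S le X p \<longleftrightarrow>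
     directed_set S le \<and>
     (\<forall>\<sigma>\<in>S. topspace (X \<sigma>) \<noteq> {}) \<and>
     (\<forall>\<sigma>\<in>S. \<forall>\<rho>\<in>S. le \<rho> \<sigma> \<longrightarrow>
        continuous_map (X \<sigma>) (X \<rho>) (p \<sigma> \<rho>) \<and> p \<sigma> \<rho> ` topspace (X \<sigma>) = topspace (X \<rho>)) \<and>
     (\<forall>\<sigma>\<in>S. \<forall>x\<in>topspace (X \<sigma>). p \<sigma> \<sigma> x = x) \<and>
     (\<forall>\<sigma>\<in>S. \<forall>\<rho>\<in>S. \<forall>\<tau>\<in>S. le \<rho> \<sigma> \<and> le \<tau> \<rho> \<longrightarrow>
        (\<forall>x\<in>topspace (X \<sigma>). p \<rho> \<tau> (p \<sigma> \<rho> x) = p \<sigma> \<tau> x))"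

definition inverse_limit ::
    "'s set \<Rightarrow> ('s \<Rightarrow> 's \<Rightarrow> bool) \<Rightarrow> ('s \<Rightarrow> 'a topology) \<Rightarrow> ('s \<Rightarrow> 's \<Rightarrow> 'a \<Rightarrow> 'a) \<Rightarrow>
     ('s \<Rightarrow> 'a) topology" where
  "inverse_limit S le X p =
     subtopology (product_topology X S)
       {x. \<forall>\<sigma>\<in>S. \<forall>\<rho>\<in>S. le \<rho> \<sigma> \<longrightarrow> p \<sigma> \<rho> (x \<sigma>) = x \<rho>}"

text \<open>
  Chains are non-empty: otherwise the continuity condition would force the space at a least index
  to be a one-point space. The equality of \<open>X \<sigma>\<close> with the limit along a chain with supremum
  \<open>\<sigma>\<close> means that the canonical map induced by the bonding maps is a homeomorphism.
\<close>

definition complete_directed_set :: "'k rel \<Rightarrow> 's set \<Rightarrow> ('s \<Rightarrow> 's \<Rightarrow> bool) \<Rightarrow> bool" where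
  "complete_directed_set \<kappa> S le \<longleftrightarrow> directed_set S le \<and>
     (\<forall>A. A \<subseteq> S \<and> A \<noteq> {} \<and> Complete_Partial_Order.chain le A \<and> |A| \<le>o \<kappa> \<longrightarrow>
        (\<exists>\<sigma>. is_lub_in S le A \<sigma>))"

definition complete_inverse_system ::
    "'k rel \<Rightarrow> 's set \<Rightarrow> ('s \<Rightarrow> 's \<Rightarrow> bool) \<Rightarrow> ('s \<Rightarrow> 'a topology) \<Rightarrow> ('s \<Rightarrow> 's \<Rightarrow> 'a \<Rightarrow> 'a) \<Rightarrow>
     bool" where
  "complete_inverse_system \<kappa> S le X p \<longleftrightarrow>
     inverse_system S le X p \<and> complete_directed_set \<kappa> S le \<and>
     (\<forall>A \<sigma>. A \<subseteq> S \<and> A \<noteq> {} \<and> Complete_Partial_Order.chain le A \<and> |A| \<le>o \<kappa> \<and>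
        is_lub_in S le A \<sigma> \<longrightarrow>
        homeomorphic_map (X \<sigma>) (inverse_limit A le X p) (\<lambda>x. \<lambda>\<alpha>\<in>A. p \<sigma> \<alpha> x))"

end

theory Submission
  imports Defs
begin

text \<open>
  A strategy is carried along a skeletal map \<open>f\<close> with dense image by playing the interior of the
  closure of \<open>f ` W\<close> whenever the given strategy plays \<open>W\<close>, and by pulling the answer back.
  The projections of a dense subset \<open>D\<close> of the limit are such maps, so \<open>\<mu> (X \<sigma>) \<le> \<mu> D\<close> for all \<open>\<sigma>\<close>.

  Conversely, \<open>\<kappa>\<close> many games are interleaved in one game of length \<open>\<kappa>\<close> on \<open>D\<close>. Each move of the
  opponent is shrunk to a basic open set, which is determined by one index, and the indices
  \<open>\<sigma> \<alpha>\<close> are chosen along the play as an increasing chain that absorbs these. On every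
  \<open>X (\<sigma> i)\<close> a full game is played using a winning strategy there. If \<open>\<tau>\<close> is the supremum of the chain,
  then \<open>X \<tau>\<close> is the limit along the chain. So the shrunk moves, which are preimages of open sets of
  \<open>X \<tau>\<close>, come from a family with dense union in \<open>X \<tau>\<close>, and preimages of dense open sets under the
  skeletal projection to \<open>X \<tau>\<close> are dense.
\<close>

section \<open>Favorable spaces and their skeletal images\<close>

text \<open>An embedding \<open>f\<close> sends earlier rounds to earlier rounds, so the game along
  \<open>r\<close> can be played at the rounds in its image; moves at other rounds only enlarge the
  union. The form for well-orders, not just cardinals, allows its use for
  \<open>Restr r E\<close>.\<close>

lemma favorable_mono:
  fixes r :: "'k rel" and r' :: "'l rel" and X :: "'a topology"
  assumes le: "r \<le>o r'" and fav: "favorable r X" and ne: "topspace X \<noteq> {}"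
  shows "favorable r' X"
proof -
  obtain f where wo: "Well_order r" and f: "embed r r' f"
    using le unfolding ordLeq_def by blast
  have inj: "inj_on f (Field r)" and fld: "f ` Field r \<subseteq> Field r'"
    using embed_inj_on[OF wo f] embed_Field[OF f] by auto
  have f_underS: "f \<beta> \<in> underS r' (f \<alpha>)" if "\<alpha> \<in> Field r" "\<beta> \<in> underS r \<alpha>" for \<alpha> \<beta>
    using embed_underS[OF wo f that(1)] that(2) by (auto simp: bij_betw_def)
  obtain s where s: "\<forall>\<alpha>\<in>Field r. \<forall>C\<in>underS r \<alpha> \<rightarrow>\<^sub>E nonempty_opens X. s \<alpha> C \<in> nonempty_opens X"
    and win: "\<forall>B. (\<forall>\<alpha>\<in>Field r. B \<alpha> \<in> nonempty_opens X \<and> B \<alpha> \<subseteq> s \<alpha> (restrict B (underS r \<alpha>)))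
      \<longrightarrow> X closure_of (\<Union>\<alpha>\<in>Field r. B \<alpha>) = topspace X"
    using fav unfolding favorable_def by (elim exE conjE)
  define t where "t \<alpha>' C = (if \<alpha>' \<in> f ` Field r
      then let \<alpha> = the_inv_into (Field r) f \<alpha>' in s \<alpha> (restrict (C \<circ> f) (underS r \<alpha>))
      else topspace X)" for \<alpha>' C
  have t_f: "t (f \<alpha>) C = s \<alpha> (restrict (C \<circ> f) (underS r \<alpha>))" if "\<alpha> \<in> Field r" for \<alpha> C
    using that inj by (simp add: t_def the_inv_into_f_f)
  show ?thesis
    unfolding favorable_def
  proof (intro exI[of _ t] conjI ballI allI impI)
    fix \<alpha>' C assume \<alpha>': "\<alpha>' \<in> Field r'" and C: "C \<in> underS r' \<alpha>' \<rightarrow>\<^sub>E nonempty_opens X"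
    show "t \<alpha>' C \<in> nonempty_opens X"
    proof (cases "\<alpha>' \<in> f ` Field r")
      case True
      then obtain \<alpha> where \<alpha>: "\<alpha> \<in> Field r" "\<alpha>' = f \<alpha>" by blast
      have "restrict (C \<circ> f) (underS r \<alpha>) \<in> underS r \<alpha> \<rightarrow>\<^sub>E nonempty_opens X"
        using f_underS[OF \<alpha>(1)] C \<alpha>(2) by (auto simp: PiE_iff)
      then show ?thesis
        using s \<alpha> by (simp add: t_f)
    next
      case False
      then show ?thesis
        using ne by (simp add: t_def nonempty_opens_def)
    qed
  next
    fix B assume B: "\<forall>\<alpha>\<in>Field r'. B \<alpha> \<in> nonempty_opens X \<and> B \<alpha> \<subseteq> t \<alpha> (restrict B (underS r' \<alpha>))"
    have eq: "restrict (restrict B (underS r' (f \<alpha>)) \<circ> f) (underS r \<alpha>) = restrict (B \<circ> f) (underS r \<alpha>)"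
      if "\<alpha> \<in> Field r" for \<alpha>
      using f_underS[OF that] by (auto simp: restrict_def fun_eq_iff)
    have "X closure_of (\<Union>\<alpha>\<in>Field r. (B \<circ> f) \<alpha>) = topspace X"
    proof (rule win[THEN spec, THEN mp], intro ballI)
      fix \<alpha> assume \<alpha>: "\<alpha> \<in> Field r"
      show "(B \<circ> f) \<alpha> \<in> nonempty_opens X \<and> (B \<circ> f) \<alpha> \<subseteq> s \<alpha> (restrict (B \<circ> f) (underS r \<alpha>))"
        using B[rule_format, of "f \<alpha>"] fld \<alpha> t_f[OF \<alpha>, of "restrict B (underS r' (f \<alpha>))"]
        by (auto simp: eq)
    qed
    moreover have "(\<Union>\<alpha>\<in>Field r. (B \<circ> f) \<alpha>) \<subseteq> (\<Union>\<alpha>\<in>Field r'. B \<alpha>)"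
      using fld by auto
    ultimately show "X closure_of (\<Union>\<alpha>\<in>Field r'. B \<alpha>) = topspace X"
      using closure_of_mono[of _ _ X] by (metis closure_of_subset_topspace subset_antisym)
  qed
qed

text \<open>The image of \<open>Field r\<close> under an embedding lies in the target type, and its
  cardinality is the copy. Minimality in \<open>is_mu\<close> and \<open>is_card_Sup\<close>
  quantifies over one type only, so competitors from other types must be copied there first.\<close>

lemma Card_order_representative:
  fixes r :: "'k rel" and r' :: "'l rel"
  assumes "Card_order r" "r \<le>o r'"
  shows "\<exists>q :: 'l rel. Card_order q \<and> q =o r"
proof -
  obtain f where "Well_order r" "embed r r' f"
    using assms(2) unfolding ordLeq_def by blast
  then have "inj_on f (Field r)"
    by (rule embed_inj_on)
  then have "|f ` Field r| =o |Field r|"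
    using card_of_ordIso bij_betw_imageI ordIso_symmetric by blast
  then have "|f ` Field r| =o r"
    using card_of_Field_ordIso[OF assms(1)] ordIso_transitive by blast
  then show ?thesis
    using card_of_Card_order by blast
qed

lemma Cinfinite_mu: "topspace X \<noteq> {} \<Longrightarrow> Cinfinite (mu X)"
  and favorable_mu: "topspace X \<noteq> {} \<Longrightarrow> favorable (mu X) X"
  using is_mu_mu[of X] by (auto simp: is_mu_def)

text \<open>A counterexample \<open>r\<close> would be smaller than \<open>mu X\<close>, hence have
  a copy on the type of \<open>mu X\<close>, where minimality is known.\<close>

lemma mu_le:
  fixes r :: "'k rel"
  assumes ne: "topspace X \<noteq> {}" and r: "Cinfinite r" and fav: "favorable r X"
  shows "mu X \<le>o r"
proof (rule ccontr)
  have wo: "Well_order r" "Well_order (mu X)"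
    using r Cinfinite_mu[OF ne] by (auto simp: card_order_on_well_order_on)
  assume "\<not> mu X \<le>o r"
  then have less: "r <o mu X"
    using wo not_ordLeq_iff_ordLess by blast
  then obtain q :: "('a set + nat) rel" where q: "Card_order q" "q =o r"
    using Card_order_representative r ordLess_imp_ordLeq by blast
  have "r =o q"
    using q(2) by (rule ordIso_symmetric)
  then have "Cinfinite q" "favorable q X"
    using favorable_mono[OF ordIso_imp_ordLeq fav ne] r Cinfinite_cong by blast+
  then have "mu X \<le>o q"
    using is_mu_mu[OF ne] by (simp add: is_mu_def)
  then have "mu X \<le>o r"
    using q(2) ordLeq_ordIso_trans by blast
  then show False
    using \<open>\<not> mu X \<le>o r\<close> by blast
qed

section \<open>Strategies as operators on whole plays\<close>

definition nonanticipating :: "'k rel \<Rightarrow> (('k \<Rightarrow> 'b) \<Rightarrow> 'k \<Rightarrow> 'c) \<Rightarrow> bool" where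
  "nonanticipating r F \<longleftrightarrow>
    (\<forall>C C'. \<forall>\<alpha>\<in>Field r. (\<forall>\<beta>\<in>underS r \<alpha>. C \<beta> = C' \<beta>) \<longrightarrow> F C \<alpha> = F C' \<alpha>)"

lemma nonanticipatingD:
  "nonanticipating r F \<Longrightarrow> \<alpha> \<in> Field r \<Longrightarrow> (\<And>\<beta>. \<beta> \<in> underS r \<alpha> \<Longrightarrow> C \<beta> = C' \<beta>) \<Longrightarrow> F C \<alpha> = F C' \<alpha>"
  unfolding nonanticipating_def by blast

text \<open>Well-founded recursion along \<open>r - Id\<close>: as \<Phi> sees only earlier values
  of \<open>F C\<close> and earlier moves of \<open>C\<close>, induction shows that
  \<open>F C \<alpha>\<close> depends on \<open>C\<close> below \<alpha> only.\<close>

lemma nonanticipating_recursion: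
  assumes wo: "Well_order r"
  shows "\<exists>F :: ('k \<Rightarrow> 'b) \<Rightarrow> 'k \<Rightarrow> 'c.
    (\<forall>C \<alpha>. F C \<alpha> = \<Phi> \<alpha> (restrict (F C) (underS r \<alpha>)) (restrict C (underS r \<alpha>))) \<and>
    nonanticipating r F"
proof -
  define F where "F C = wfrec (r - Id)
      (\<lambda>f \<alpha>. \<Phi> \<alpha> (restrict f (underS r \<alpha>)) (restrict C (underS r \<alpha>)))" for C
  have wf: "wf (r - Id)"
    using wo by (simp add: well_order_on_def)
  have F: "F C \<alpha> = \<Phi> \<alpha> (restrict (F C) (underS r \<alpha>)) (restrict C (underS r \<alpha>))" for C \<alpha>
  proof -
    have "restrict (cut (F C) (r - Id) \<alpha>) (underS r \<alpha>) = restrict (F C) (underS r \<alpha>)"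
      by (auto simp: cut_def underS_def restrict_def)
    then show ?thesis
      unfolding F_def by (subst wfrec[OF wf]) simp
  qed
  have "nonanticipating r F"
    unfolding nonanticipating_def
  proof (intro allI ballI impI)
    fix C C' :: "'k \<Rightarrow> 'b" and \<alpha> assume "\<forall>\<beta>\<in>underS r \<alpha>. C \<beta> = C' \<beta>"
    then show "F C \<alpha> = F C' \<alpha>"
    proof (induction \<alpha> rule: wf_induct_rule[OF wf])
      case (1 \<alpha>)
      have "F C \<beta> = F C' \<beta>" if \<beta>: "\<beta> \<in> underS r \<alpha>" for \<beta>
      proof (rule "1.IH")
        show "(\<beta>, \<alpha>) \<in> r - Id"
          using \<beta> by (simp add: underS_def)
        have "trans r" "antisym r"
          using wo by (auto simp: order_on_defs)
        then have "underS r \<beta> \<subseteq> underS r \<alpha>"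
          using \<beta> by (auto simp: underS_def dest: transD antisymD)
        then show "\<forall>\<gamma>\<in>underS r \<beta>. C \<gamma> = C' \<gamma>"
          using "1.prems" by blast
      qed
      then have "restrict (F C) (underS r \<alpha>) = restrict (F C') (underS r \<alpha>)"
        "restrict C (underS r \<alpha>) = restrict C' (underS r \<alpha>)"
        using "1.prems" by (auto simp: restrict_def)
      then show ?case
        by (simp add: F[of C \<alpha>] F[of C' \<alpha>])
    qed
  qed
  with F show ?thesis
    by blast
qed

text \<open>The strategy is \<open>\<lambda>\<alpha> C. P C \<alpha>\<close>: truncating a play to
  the rounds before \<alpha> does not change the answer at \<alpha>.\<close>

lemma favorableI:
  assumes na: "nonanticipating r P"
    and P: "\<And>\<alpha> C. \<alpha> \<in> Field r \<Longrightarrow> (\<And>\<beta>. \<beta> \<in> underS r \<alpha> \<Longrightarrow> C \<beta> \<in> nonempty_opens X) \<Longrightarrow>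
      P C \<alpha> \<in> nonempty_opens X"
    and win: "\<And>B. (\<And>\<alpha>. \<alpha> \<in> Field r \<Longrightarrow> B \<alpha> \<in> nonempty_opens X \<and> B \<alpha> \<subseteq> P B \<alpha>) \<Longrightarrow>
      X closure_of (\<Union>\<alpha>\<in>Field r. B \<alpha>) = topspace X"
  shows "favorable r X"
proof -
  have "P (restrict B (underS r \<alpha>)) \<alpha> = P B \<alpha>" if "\<alpha> \<in> Field r" for B \<alpha>
    using na that by (rule nonanticipatingD) simp
  then show ?thesis
    unfolding favorable_def using P win
    by (intro exI[of _ "\<lambda>\<alpha> C. P C \<alpha>"]) (auto simp: PiE_iff)
qed

text \<open>A play on \<open>Y\<close> is shadowed by a play on \<open>X\<close>. An answer inside
  the interior of the closure of the image of \<open>W\<close> meets that image, so its preimage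
  cuts \<open>W\<close> in a legal answer on \<open>X\<close>. Dense image, in place of
  surjectivity, is what projections of a dense subset of the limit provide.\<close>

lemma favorable_dense_image:
  assumes wo: "Well_order r" and fav: "favorable r X" and ne: "topspace X \<noteq> {}"
    and cont: "continuous_map X Y f"
    and dense: "Y closure_of (f ` topspace X) = topspace Y"
    and int: "\<And>U. openin X U \<Longrightarrow> U \<noteq> {} \<Longrightarrow> Y interior_of (Y closure_of (f ` U)) \<noteq> {}"
  shows "favorable r Y"
proof -
  obtain s where s: "\<forall>\<alpha>\<in>Field r. \<forall>C\<in>underS r \<alpha> \<rightarrow>\<^sub>E nonempty_opens X. s \<alpha> C \<in> nonempty_opens X"
    and win: "\<forall>B. (\<forall>\<alpha>\<in>Field r. B \<alpha> \<in> nonempty_opens X \<and> B \<alpha> \<subseteq> s \<alpha> (restrict B (underS r \<alpha>)))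
      \<longrightarrow> X closure_of (\<Union>\<alpha>\<in>Field r. B \<alpha>) = topspace X"
    using fav unfolding favorable_def by (elim exE conjE)
  \<comment> \<open>\<open>a w c\<close> is the answer on \<open>X\<close> that shadows the answer
    \<open>c\<close> on \<open>Y\<close>. The default \<open>topspace X\<close> below keeps the
    history legal in plays that break the rules.\<close>
  define a where "a w c = w \<inter> {x \<in> topspace X. f x \<in> c}" for w c
  define \<Phi> where "\<Phi> \<alpha> w c = s \<alpha> (\<lambda>\<beta>\<in>underS r \<alpha>.
      let A = a (w \<beta>) (c \<beta>) in if A \<in> nonempty_opens X then A else topspace X)" for \<alpha> w c
  obtain W where W: "\<forall>C \<alpha>. W C \<alpha> = \<Phi> \<alpha> (restrict (W C) (underS r \<alpha>)) (restrict C (underS r \<alpha>))"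
    and na: "nonanticipating r W"
    using nonanticipating_recursion[OF wo, of \<Phi>] by (elim exE conjE)
  define A where "A C \<beta> = (let A = a (W C \<beta>) (C \<beta>) in if A \<in> nonempty_opens X then A else topspace X)" for C \<beta>
  have W': "W C \<alpha> = s \<alpha> (restrict (A C) (underS r \<alpha>))" for C \<alpha>
    unfolding W[rule_format, of C \<alpha>] A_def \<Phi>_def by (intro arg_cong[of _ _ "s \<alpha>"]) (auto simp: restrict_def fun_eq_iff)
  have A: "A C \<beta> \<in> nonempty_opens X" for C \<beta>
    using ne by (simp add: A_def Let_def nonempty_opens_def)
  define P where "P C \<alpha> = Y interior_of (Y closure_of (f ` W C \<alpha>))" for C \<alpha>
  have W_open: "W C \<alpha> \<in> nonempty_opens X" if "\<alpha> \<in> Field r" for C \<alpha>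
    unfolding W'[of C \<alpha>] using A by (intro s[rule_format] that) simp
  show ?thesis
  proof (rule favorableI[where P = P])
    show "nonanticipating r P"
      using na unfolding nonanticipating_def P_def by metis
    show "P C \<alpha> \<in> nonempty_opens Y" if "\<alpha> \<in> Field r" for \<alpha> C
      using int W_open[OF that] by (auto simp: P_def nonempty_opens_def)
  next
    fix B assume B: "\<And>\<alpha>. \<alpha> \<in> Field r \<Longrightarrow> B \<alpha> \<in> nonempty_opens Y \<and> B \<alpha> \<subseteq> P B \<alpha>"
    have A_eq: "A B \<alpha> = a (W B \<alpha>) (B \<alpha>)" if \<alpha>: "\<alpha> \<in> Field r" for \<alpha>
    proof -
      have "B \<alpha> \<subseteq> Y closure_of (f ` W B \<alpha>)"
        using B[OF \<alpha>] interior_of_subset[of Y] unfolding P_def by (meson order_trans)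
      moreover have "openin Y (B \<alpha>)" "B \<alpha> \<noteq> {}"
        using B[OF \<alpha>] by (auto simp: nonempty_opens_def)
      ultimately have "f ` W B \<alpha> \<inter> B \<alpha> \<noteq> {}"
        using openin_Int_closure_of_eq_empty[of Y "B \<alpha>" "f ` W B \<alpha>"] by auto
      moreover have "openin X (W B \<alpha>)"
        using W_open[OF \<alpha>] by (simp add: nonempty_opens_def)
      ultimately have "a (W B \<alpha>) (B \<alpha>) \<noteq> {}"
        using openin_subset[of X "W B \<alpha>"] by (auto simp: a_def)
      moreover have "openin X (a (W B \<alpha>) (B \<alpha>))"
        unfolding a_def using \<open>openin Y (B \<alpha>)\<close> \<open>openin X (W B \<alpha>)\<close> cont
        by (intro openin_Int openin_continuous_map_preimage)
      ultimately show ?thesis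
        by (simp add: A_def nonempty_opens_def)
    qed
    have "X closure_of (\<Union>\<alpha>\<in>Field r. A B \<alpha>) = topspace X"
    proof (rule win[THEN spec, THEN mp], intro ballI)
      fix \<alpha> assume \<alpha>: "\<alpha> \<in> Field r"
      have "A B \<alpha> \<subseteq> W B \<alpha>"
        using A_eq[OF \<alpha>] by (simp add: a_def)
      then show "A B \<alpha> \<in> nonempty_opens X \<and> A B \<alpha> \<subseteq> s \<alpha> (restrict (A B) (underS r \<alpha>))"
        using A W' by simp
    qed
    \<comment> \<open>The shadow moves have dense union in \<open>X\<close> and map into the moves
      on \<open>Y\<close>, so the closure of the union of the latter contains the dense image of
      \<open>X\<close>.\<close>
    then have "f ` topspace X \<subseteq> Y closure_of (f ` (\<Union>\<alpha>\<in>Field r. A B \<alpha>))"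
      using continuous_map_image_closure_subset[OF cont, of "\<Union>\<alpha>\<in>Field r. A B \<alpha>"] by simp
    moreover have "f ` (\<Union>\<alpha>\<in>Field r. A B \<alpha>) \<subseteq> (\<Union>\<alpha>\<in>Field r. B \<alpha>)"
      by (auto simp: A_eq a_def)
    ultimately have "f ` topspace X \<subseteq> Y closure_of (\<Union>\<alpha>\<in>Field r. B \<alpha>)"
      using closure_of_mono order_trans by metis
    then have "Y closure_of (f ` topspace X) \<subseteq> Y closure_of (\<Union>\<alpha>\<in>Field r. B \<alpha>)"
      by (rule closure_of_minimal) simp
    then have "topspace Y \<subseteq> Y closure_of (\<Union>\<alpha>\<in>Field r. B \<alpha>)"
      by (simp only: dense)
    then show "Y closure_of (\<Union>\<alpha>\<in>Field r. B \<alpha>) = topspace Y"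
      by (intro subset_antisym closure_of_subset_topspace)
  qed
qed

section \<open>Inverse limits\<close>

lemma topspace_inverse_limit:
  "topspace (inverse_limit S le X p) =
    {x \<in> \<Pi>\<^sub>E \<sigma>\<in>S. topspace (X \<sigma>). \<forall>\<sigma>\<in>S. \<forall>\<rho>\<in>S. le \<rho> \<sigma> \<longrightarrow> p \<sigma> \<rho> (x \<sigma>) = x \<rho>}"
  by (auto simp: inverse_limit_def)

lemma continuous_map_inverse_limit_projection:
  "\<sigma> \<in> S \<Longrightarrow> continuous_map (inverse_limit S le X p) (X \<sigma>) (\<lambda>x. x \<sigma>)"
  unfolding inverse_limit_def
  by (intro continuous_map_from_subtopology continuous_map_product_projection)

lemma directed_set_finite_upper_bound:
  assumes dir: "directed_set S le" and "finite F" "F \<subseteq> S"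
  shows "\<exists>\<tau>\<in>S. \<forall>\<sigma>\<in>F. le \<sigma> \<tau>"
  using assms(2,3)
proof (induction F rule: finite_induct)
  case empty
  then show ?case
    using dir by (auto simp: directed_set_def)
next
  case (insert \<rho> F)
  then obtain \<tau> where \<tau>: "\<tau> \<in> S" "\<forall>\<sigma>\<in>F. le \<sigma> \<tau>" by auto
  moreover obtain \<upsilon> where \<upsilon>: "\<upsilon> \<in> S" "le \<rho> \<upsilon>" "le \<tau> \<upsilon>"
    using dir \<tau>(1) insert.prems unfolding directed_set_def by blast
  moreover have "le \<sigma> \<upsilon>" if "\<sigma> \<in> F" for \<sigma>
    using dir \<tau> \<upsilon> that insert.prems unfolding directed_set_def by (blast dest: transp_onD)
  ultimately show ?case by auto
qed

text \<open>A product neighbourhood restricts finitely many coordinates; at a common upper bound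
  \<tau> of these, the restrictions pull back along the bonding maps to a single open set.\<close>

lemma inverse_limit_basis:
  assumes inv: "inverse_system S le X p"
    and U: "openin (inverse_limit S le X p) U" and x: "x \<in> U"
  shows "\<exists>\<tau>\<in>S. \<exists>V. openin (X \<tau>) V \<and> x \<tau> \<in> V \<and>
    {y \<in> topspace (inverse_limit S le X p). y \<tau> \<in> V} \<subseteq> U"
proof -
  let ?L = "inverse_limit S le X p"
  have xL: "x \<in> topspace ?L"
    using U x openin_subset by blast
  obtain T where T: "openin (product_topology X S) T"
    and UT: "U = T \<inter> {x. \<forall>\<sigma>\<in>S. \<forall>\<rho>\<in>S. le \<rho> \<sigma> \<longrightarrow> p \<sigma> \<rho> (x \<sigma>) = x \<rho>}"
    using U unfolding inverse_limit_def openin_subtopology by auto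
  have "x \<in> T" using x UT by blast
  then obtain W where fin: "finite {i \<in> S. W i \<noteq> topspace (X i)}"
    and W: "\<And>i. i \<in> S \<Longrightarrow> openin (X i) (W i)" and xW: "x \<in> Pi\<^sub>E S W" and WT: "Pi\<^sub>E S W \<subseteq> T"
    using T unfolding openin_product_topology_alt by meson
  define F where "F = {i \<in> S. W i \<noteq> topspace (X i)}"
  have dir: "directed_set S le"
    using inv by (simp add: inverse_system_def)
  obtain \<tau> where \<tau>: "\<tau> \<in> S" "\<And>i. i \<in> F \<Longrightarrow> le i \<tau>"
    using directed_set_finite_upper_bound[OF dir, of F] fin by (auto simp: F_def)
  \<comment> \<open>The last intersection covers the case of empty \<open>F\<close>, where the
    indexed intersection is the whole type.\<close>
  define V where "V = (\<Inter>i\<in>F. {z \<in> topspace (X \<tau>). p \<tau> i z \<in> W i}) \<inter> topspace (X \<tau>)"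
  have "openin (X \<tau>) V"
    unfolding V_def
  proof (rule openin_INT)
    show "finite F" using fin by (simp add: F_def)
    fix i assume i: "i \<in> F"
    then have "i \<in> S" by (simp add: F_def)
    then have "continuous_map (X \<tau>) (X i) (p \<tau> i)"
      using inv \<tau> i unfolding inverse_system_def by blast
    then show "openin (X \<tau>) {z \<in> topspace (X \<tau>). p \<tau> i z \<in> W i}"
      using W[OF \<open>i \<in> S\<close>] by (rule openin_continuous_map_preimage)
  qed
  moreover have y\<tau>: "p \<tau> i (y \<tau>) = y i" if "y \<in> topspace ?L" "i \<in> F" for y i
    using that \<tau> by (auto simp: topspace_inverse_limit F_def)
  have "x \<tau> \<in> V"
    using xL xW \<tau>(1) y\<tau>[OF xL] by (auto simp: V_def topspace_inverse_limit F_def)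
  moreover have "y \<in> U" if y: "y \<in> topspace ?L" "y \<tau> \<in> V" for y
  proof -
    have "y i \<in> W i" if "i \<in> S" for i
    proof (cases "i \<in> F")
      case True
      then show ?thesis using y y\<tau>[OF y(1) True] by (auto simp: V_def)
    next
      case False
      then show ?thesis using y that by (auto simp: F_def topspace_inverse_limit)
    qed
    then have "y \<in> Pi\<^sub>E S W"
      using y(1) by (auto simp: topspace_inverse_limit PiE_iff)
    then show ?thesis
      using WT y(1) by (auto simp: UT topspace_inverse_limit)
  qed
  ultimately show ?thesis
    using \<tau>(1) by blast
qed

lemma inverse_system_subset:
  assumes "inverse_system S le X p" "A \<subseteq> S" "directed_set A le"
  shows "inverse_system A le X p"
  using assms unfolding inverse_system_def subset_iff by simp

lemma directed_set_chain:
  assumes "directed_set S le" "A \<subseteq> S" "A \<noteq> {}" "Complete_Partial_Order.chain le A"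
  shows "directed_set A le"
proof -
  have refl: "reflp_on A le" and "transp_on A le"
    using assms by (auto simp: directed_set_def intro: reflp_on_subset transp_on_subset)
  moreover have "\<exists>\<upsilon>\<in>A. le \<sigma> \<upsilon> \<and> le \<tau> \<upsilon>" if "\<sigma> \<in> A" "\<tau> \<in> A" for \<sigma> \<tau>
    using that assms(4) refl unfolding chain_def by (meson reflp_onD)
  ultimately show ?thesis
    using assms(3) by (simp add: directed_set_def)
qed

text \<open>Projections of a dense set inherit skeletality from the bonding maps: \<open>U\<close>
  contains the trace of a basic set with some index \<tau>, and pulling this set back to an index
  above both \<sigma> and \<tau> allows a bonding map to carry it to
  \<open>X \<sigma>\<close>.\<close>

lemma interior_closure_projection_nonempty:
  assumes inv: "inverse_system S le X p"
    and surj: "\<And>\<sigma>. \<sigma> \<in> S \<Longrightarrow> (\<lambda>x. x \<sigma>) ` topspace (inverse_limit S le X p) = topspace (X \<sigma>)"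
    and skeletal: "\<And>\<sigma> \<rho>. \<sigma> \<in> S \<Longrightarrow> \<rho> \<in> S \<Longrightarrow> le \<rho> \<sigma> \<Longrightarrow> skeletal_map (X \<sigma>) (X \<rho>) (p \<sigma> \<rho>)"
    and dense: "inverse_limit S le X p closure_of D = topspace (inverse_limit S le X p)"
    and \<sigma>: "\<sigma> \<in> S"
    and U: "openin (subtopology (inverse_limit S le X p) D) U" "U \<noteq> {}"
  shows "X \<sigma> interior_of (X \<sigma> closure_of ((\<lambda>x. x \<sigma>) ` U)) \<noteq> {}"
proof -
  let ?L = "inverse_limit S le X p"
  obtain T where T: "openin ?L T" "U = T \<inter> D"
    using U(1) by (auto simp: openin_subtopology)
  obtain x where x: "x \<in> T" using U(2) T(2) by blast
  obtain \<tau> V where \<tau>: "\<tau> \<in> S" and V: "openin (X \<tau>) V" "x \<tau> \<in> V" "{y \<in> topspace ?L. y \<tau> \<in> V} \<subseteq> T"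
    using inverse_limit_basis[OF inv T(1) x] by blast
  obtain \<upsilon> where \<upsilon>: "\<upsilon> \<in> S" "le \<sigma> \<upsilon>" "le \<tau> \<upsilon>"
    using inv \<sigma> \<tau> unfolding inverse_system_def directed_set_def by blast
  define V' where "V' = {z \<in> topspace (X \<upsilon>). p \<upsilon> \<tau> z \<in> V}"
  have xL: "x \<in> topspace ?L"
    using x T(1) openin_subset by blast
  have "continuous_map (X \<upsilon>) (X \<tau>) (p \<upsilon> \<tau>)"
    using inv \<tau> \<upsilon> unfolding inverse_system_def by blast
  then have "openin (X \<upsilon>) V'"
    unfolding V'_def using V(1) by (rule openin_continuous_map_preimage)
  moreover have "x \<upsilon> \<in> V'"
    using xL V(2) \<tau> \<upsilon> by (auto simp: V'_def topspace_inverse_limit)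
  ultimately have "X \<sigma> interior_of (X \<sigma> closure_of (p \<upsilon> \<sigma> ` V')) \<noteq> {}"
    using skeletal[OF \<upsilon>(1) \<sigma> \<upsilon>(2)] unfolding skeletal_map_def by blast
  \<comment> \<open>A point of \<open>V'\<close> lifts to a thread in \<open>T\<close> by
    surjectivity of the projection; density of \<open>D\<close> puts this thread in the closure of
    \<open>U\<close>.\<close>
  moreover have "p \<upsilon> \<sigma> ` V' \<subseteq> X \<sigma> closure_of ((\<lambda>x. x \<sigma>) ` U)"
  proof
    fix w assume "w \<in> p \<upsilon> \<sigma> ` V'"
    then obtain z where z: "z \<in> topspace (X \<upsilon>)" "p \<upsilon> \<tau> z \<in> V" "w = p \<upsilon> \<sigma> z"
      by (auto simp: V'_def)
    then obtain y where y: "y \<in> topspace ?L" "z = y \<upsilon>"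
      using surj[OF \<upsilon>(1)] by blast
    then have eqs: "p \<upsilon> \<tau> z = y \<tau>" "p \<upsilon> \<sigma> z = y \<sigma>"
      using \<sigma> \<tau> \<upsilon> by (auto simp: topspace_inverse_limit)
    then have "y \<in> T"
      using z(2) y(1) V(3) by auto
    then have "y \<in> ?L closure_of U"
      using openin_Int_closure_of_subset[OF T(1), of D] y(1) dense T(2) by blast
    then have "y \<sigma> \<in> X \<sigma> closure_of ((\<lambda>x. x \<sigma>) ` U)"
      using continuous_map_image_closure_subset[OF continuous_map_inverse_limit_projection[OF \<sigma>],
          of le X p U] by blast
    then show "w \<in> X \<sigma> closure_of ((\<lambda>x. x \<sigma>) ` U)"
      using z(3) eqs by simp
  qed
  then have "X \<sigma> closure_of (p \<upsilon> \<sigma> ` V') \<subseteq> X \<sigma> closure_of ((\<lambda>x. x \<sigma>) ` U)"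
    by (rule closure_of_minimal) simp
  ultimately show ?thesis
    using interior_of_mono by blast
qed

lemma projection_image_dense:
  assumes surj: "(\<lambda>x. x \<sigma>) ` topspace (inverse_limit S le X p) = topspace (X \<sigma>)"
    and dense: "inverse_limit S le X p closure_of D = topspace (inverse_limit S le X p)"
    and \<sigma>: "\<sigma> \<in> S"
  shows "X \<sigma> closure_of ((\<lambda>x. x \<sigma>) ` D) = topspace (X \<sigma>)"
  using continuous_map_image_closure_subset[OF continuous_map_inverse_limit_projection[OF \<sigma>], of le X p D]
    surj dense closure_of_subset_topspace[of "X \<sigma>"] by blast

section \<open>Interleaving the games\<close>

text \<open>Let \<open>h\<close> be a bijection of \<open>Field r\<close> with its square. Each
  \<open>i\<close> is the first coordinate of \<open>h \<alpha>\<close> for \<open>r\<close>-many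
  \<alpha>; all of these but the fewer than \<open>r\<close> lying below \<open>i\<close> satisfy
  \<open>g \<alpha> = i\<close>.\<close>

lemma Cinfinite_partition:
  fixes r :: "'k rel"
  assumes r: "Cinfinite r"
  shows "\<exists>g. (\<forall>\<alpha>\<in>Field r. (g \<alpha>, \<alpha>) \<in> r) \<and> (\<forall>i\<in>Field r. |{\<alpha> \<in> Field r. g \<alpha> = i}| =o r)"
proof -
  have inf: "infinite (Field r)" and card: "Card_order r"
    using r by (auto simp: cinfinite_def)
  have refl: "(\<alpha>, \<alpha>) \<in> r" if "\<alpha> \<in> Field r" for \<alpha>
    using card that by (simp add: card_order_on_def order_on_defs refl_on_def)
  have "total_on (Field r) r"
    using card by (simp add: card_order_on_def order_on_defs)
  then have dichotomy: "(a, b) \<in> r \<or> (b, a) \<in> r \<and> b \<noteq> a" if "a \<in> Field r" "b \<in> Field r" for a b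
    using that refl[of a] by (cases "a = b") (auto simp: total_on_def)
  have Field_r: "|Field r| =o r"
    using card by (rule card_of_Field_ordIso)
  obtain h where h: "bij_betw h (Field r) (Field r \<times> Field r)"
    using card_of_Times_same_infinite[OF inf] card_of_ordIso ordIso_symmetric by blast
  \<comment> \<open>The fallback to \<alpha> keeps \<open>g \<alpha>\<close> at most \<alpha> and
    can only enlarge fibres.\<close>
  define g where "g \<alpha> = (if (fst (h \<alpha>), \<alpha>) \<in> r then fst (h \<alpha>) else \<alpha>)" for \<alpha>
  have "|{\<alpha> \<in> Field r. g \<alpha> = i}| =o r" if i: "i \<in> Field r" for i
  proof -
    let ?E = "{\<alpha> \<in> Field r. g \<alpha> = i}"
    have "inj_on (\<lambda>j. inv_into (Field r) h (i, j)) (Field r)"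
      using h i by (auto intro!: inj_onI dest!: inv_into_injective simp: bij_betw_def)
    moreover have "inv_into (Field r) h (i, j) \<in> ?E \<union> underS r i" if j: "j \<in> Field r" for j
    proof -
      let ?\<alpha> = "inv_into (Field r) h (i, j)"
      have \<alpha>: "?\<alpha> \<in> Field r" "fst (h ?\<alpha>) = i"
        using h i j by (auto simp: bij_betw_def f_inv_into_f intro!: inv_into_into)
      have "(i, ?\<alpha>) \<in> r \<or> (?\<alpha>, i) \<in> r \<and> ?\<alpha> \<noteq> i"
        using i \<alpha>(1) by (rule dichotomy)
      then show ?thesis
        using \<alpha> by (auto simp: g_def underS_def)
    qed
    ultimately have "|Field r| \<le>o |?E \<union> underS r i|"
      using card_of_ordLeq by blast
    then have "r \<le>o |?E \<union> underS r i|"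
      using Field_r ordIso_ordLeq_trans ordIso_symmetric by blast
    then have "\<not> |?E \<union> underS r i| <o r"
      using not_ordLess_ordLeq by blast
    then have "\<not> |?E| <o r"
      using card_of_Un_ordLess_infinite_Field[OF inf card] card_of_underS[OF card i] by blast
    then have "r \<le>o |?E|"
      using card card_of_Well_order card_order_on_well_order_on not_ordLess_iff_ordLeq by blast
    moreover have "|?E| \<le>o |Field r|"
      by (rule card_of_mono1) blast
    then have "|?E| \<le>o r"
      using Field_r ordLeq_ordIso_trans by blast
    ultimately show ?thesis
      by (simp add: ordIso_iff_ordLeq)
  qed
  moreover have "(g \<alpha>, \<alpha>) \<in> r" if "\<alpha> \<in> Field r" for \<alpha>
    using refl[OF that] by (simp add: g_def)
  ultimately show ?thesis
    by blast
qed

text \<open>A cardinal is a least well-order of its size, so the rounds in \<open>E\<close>, ordered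
  as in \<open>r\<close>, have at least the length \<open>r\<close>, and favorability passes to
  \<open>Restr r E\<close> by monotonicity.\<close>

lemma favorable_Restr:
  fixes r :: "'k rel" and X :: "'a topology"
  assumes r: "Card_order r" and E: "E \<subseteq> Field r" "|E| =o r"
    and fav: "favorable r X" and ne: "topspace X \<noteq> {}"
  shows "\<exists>s. (\<forall>\<alpha>\<in>E. \<forall>C\<in>underS r \<alpha> \<inter> E \<rightarrow>\<^sub>E nonempty_opens X. s \<alpha> C \<in> nonempty_opens X) \<and>
    (\<forall>B. (\<forall>\<alpha>\<in>E. B \<alpha> \<in> nonempty_opens X \<and> B \<alpha> \<subseteq> s \<alpha> (restrict B (underS r \<alpha> \<inter> E))) \<longrightarrow>
       X closure_of (\<Union>\<alpha>\<in>E. B \<alpha>) = topspace X)"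
proof -
  have wo: "Well_order r"
    using r by (simp add: card_order_on_def)
  have "well_order_on E (Restr r E)"
    using wo E(1) by (rule well_order_on_Restr)
  then have "|E| \<le>o Restr r E"
    by (rule card_of_least)
  moreover have "r \<le>o |E|"
    using E(2) ordIso_iff_ordLeq by blast
  ultimately have "favorable (Restr r E) X"
    using favorable_mono[OF _ fav ne] ordLeq_transitive by blast
  moreover have "Field (Restr r E) = E"
    using \<open>well_order_on E (Restr r E)\<close> well_order_on_Field by metis
  moreover have "underS (Restr r E) \<alpha> = underS r \<alpha> \<inter> E" if "\<alpha> \<in> E" for \<alpha>
    using that by (auto simp: underS_def)
  ultimately show ?thesis
    unfolding favorable_def by simp
qed

text \<open>Taking the index above a prescribed \<sigma> is what makes the indices increase along a
  play.\<close>

lemma refine_to_basic_open: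
  assumes inv: "inverse_system S le X p"
    and D: "D \<subseteq> topspace (inverse_limit S le X p)"
    and \<sigma>: "\<sigma> \<in> S" and C: "C \<in> nonempty_opens (subtopology (inverse_limit S le X p) D)"
  shows "\<exists>\<tau> V. \<tau> \<in> S \<and> le \<sigma> \<tau> \<and> openin (X \<tau>) V \<and> {x \<in> D. x \<tau> \<in> V} \<noteq> {} \<and> {x \<in> D. x \<tau> \<in> V} \<subseteq> C"
proof -
  let ?L = "inverse_limit S le X p"
  obtain T where T: "openin ?L T" "C = T \<inter> D"
    using C by (auto simp: nonempty_opens_def openin_subtopology)
  obtain x where x: "x \<in> T" "x \<in> D"
    using C T(2) by (auto simp: nonempty_opens_def)
  obtain \<tau> V where \<tau>: "\<tau> \<in> S" and V: "openin (X \<tau>) V" "x \<tau> \<in> V" "{y \<in> topspace ?L. y \<tau> \<in> V} \<subseteq> T"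
    using inverse_limit_basis[OF inv T(1) x(1)] by blast
  obtain \<upsilon> where \<upsilon>: "\<upsilon> \<in> S" "le \<sigma> \<upsilon>" "le \<tau> \<upsilon>"
    using inv \<sigma> \<tau> unfolding inverse_system_def directed_set_def by blast
  have p: "y \<upsilon> \<in> topspace (X \<upsilon>) \<and> p \<upsilon> \<tau> (y \<upsilon>) = y \<tau>" if "y \<in> D" for y
    using subsetD[OF D that] \<tau> \<upsilon> by (auto simp: topspace_inverse_limit)
  define V' where "V' = {z \<in> topspace (X \<upsilon>). p \<upsilon> \<tau> z \<in> V}"
  have "continuous_map (X \<upsilon>) (X \<tau>) (p \<upsilon> \<tau>)"
    using inv \<tau> \<upsilon> unfolding inverse_system_def by blast
  then have "openin (X \<upsilon>) V'"
    unfolding V'_def using V(1) by (rule openin_continuous_map_preimage)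
  moreover have "x \<in> {x \<in> D. x \<upsilon> \<in> V'}"
    using x p V(2) by (simp add: V'_def)
  moreover have "{x \<in> D. x \<upsilon> \<in> V'} \<subseteq> C"
    using p V(3) D T(2) by (auto simp: V'_def)
  ultimately show ?thesis
    using \<upsilon>(1,2) by blast
qed

text \<open>The upper bound for \<open>mu\<close>: every simulated game has the same length \<kappa>
  as the play on \<open>D\<close>, which is possible by \<open>fav\<close>.\<close>

lemma favorable_dense_in_limit:
  fixes \<kappa> :: "'k rel" and X :: "'s \<Rightarrow> 'a topology"
  assumes kappa: "Cinfinite \<kappa>"
    and complete: "complete_inverse_system \<kappa> S le X p"
    and surj: "\<And>\<sigma>. \<sigma> \<in> S \<Longrightarrow> (\<lambda>x. x \<sigma>) ` topspace (inverse_limit S le X p) = topspace (X \<sigma>)"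
    and skeletal: "\<And>\<sigma> \<rho>. \<sigma> \<in> S \<Longrightarrow> \<rho> \<in> S \<Longrightarrow> le \<rho> \<sigma> \<Longrightarrow> skeletal_map (X \<sigma>) (X \<rho>) (p \<sigma> \<rho>)"
    and D: "D \<subseteq> topspace (inverse_limit S le X p)"
    and dense: "inverse_limit S le X p closure_of D = topspace (inverse_limit S le X p)"
    and fav: "\<And>\<sigma>. \<sigma> \<in> S \<Longrightarrow> favorable \<kappa> (X \<sigma>)"
  shows "favorable \<kappa> (subtopology (inverse_limit S le X p) D)"
proof -
  let ?L = "inverse_limit S le X p"
  let ?Y = "subtopology ?L D"
  have inv: "inverse_system S le X p" and cds: "complete_directed_set \<kappa> S le"
    and hom: "\<And>A \<sigma>. A \<subseteq> S \<Longrightarrow> A \<noteq> {} \<Longrightarrow> Complete_Partial_Order.chain le A \<Longrightarrow> |A| \<le>o \<kappa> \<Longrightarrow>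
        is_lub_in S le A \<sigma> \<Longrightarrow>
        homeomorphic_map (X \<sigma>) (inverse_limit A le X p) (\<lambda>x. \<lambda>\<alpha>\<in>A. p \<sigma> \<alpha> x)"
    using complete by (auto simp: complete_inverse_system_def)
  have dir: "directed_set S le"
    using inv by (simp add: inverse_system_def)
  have le_refl: "le \<sigma> \<sigma>" if "\<sigma> \<in> S" for \<sigma>
    using dir that unfolding directed_set_def by (blast dest: reflp_onD)
  have le_trans: "le \<sigma> \<upsilon>" if "le \<sigma> \<tau>" "le \<tau> \<upsilon>" "\<sigma> \<in> S" "\<tau> \<in> S" "\<upsilon> \<in> S" for \<sigma> \<tau> \<upsilon>
    using dir that unfolding directed_set_def by (blast dest: transp_onD)
  have ne: "topspace (X \<sigma>) \<noteq> {}" if "\<sigma> \<in> S" for \<sigma>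
    using inv that by (simp add: inverse_system_def)
  have proj_cont: "continuous_map ?Y (X \<sigma>) (\<lambda>x. x \<sigma>)" if "\<sigma> \<in> S" for \<sigma>
    using that by (intro continuous_map_from_subtopology continuous_map_inverse_limit_projection)
  have topY: "topspace ?Y = D"
    using D by auto
  have int_ne: "X \<sigma> interior_of (X \<sigma> closure_of ((\<lambda>x. x \<sigma>) ` U)) \<noteq> {}"
    if "\<sigma> \<in> S" "openin ?Y U" "U \<noteq> {}" for \<sigma> U
    using interior_closure_projection_nonempty[OF inv surj skeletal dense that] .
  have meets: "Q \<inter> T \<noteq> {}" if "openin Z Q" "Q \<inter> Z closure_of T \<noteq> {}" for Z :: "'a topology" and Q T
    using openin_Int_closure_of_eq_empty[OF that(1)] that(2) by blast

  \<comment> \<open>The well-order of rounds and its partition among the games\<close>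
  have card: "Card_order \<kappa>" and inf: "infinite (Field \<kappa>)"
    using kappa by (auto simp: cinfinite_def)
  have wo: "Well_order \<kappa>"
    using card by (simp add: card_order_on_def)
  have wf: "wf (\<kappa> - Id)"
    using wo by (simp add: well_order_on_def)
  have "trans \<kappa>" "antisym \<kappa>" "total_on (Field \<kappa>) \<kappa>"
    using wo by (auto simp: order_on_defs)
  have underS_trans: "\<gamma> \<in> underS \<kappa> \<alpha>" if "\<gamma> \<in> underS \<kappa> \<beta>" "(\<beta>, \<alpha>) \<in> \<kappa>" for \<alpha> \<beta> \<gamma>
    using that \<open>trans \<kappa>\<close> \<open>antisym \<kappa>\<close> by (auto simp: underS_def dest: transD antisymD)
  have underS_Field: "\<beta> \<in> Field \<kappa>" if "\<beta> \<in> underS \<kappa> \<alpha>" for \<alpha> \<beta>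
    using that by (auto simp: underS_def Field_def)
  have total: "\<alpha> = \<beta> \<or> \<alpha> \<in> underS \<kappa> \<beta> \<or> \<beta> \<in> underS \<kappa> \<alpha>" if "\<alpha> \<in> Field \<kappa>" "\<beta> \<in> Field \<kappa>" for \<alpha> \<beta>
    using that \<open>total_on (Field \<kappa>) \<kappa>\<close> by (auto simp: underS_def total_on_def)

  obtain g where g: "\<forall>\<alpha>\<in>Field \<kappa>. (g \<alpha>, \<alpha>) \<in> \<kappa>"
    and g_fibre: "\<forall>i\<in>Field \<kappa>. |{\<alpha> \<in> Field \<kappa>. g \<alpha> = i}| =o \<kappa>"
    using Cinfinite_partition[OF kappa] by (elim exE conjE)
  define E where "E i = {\<alpha> \<in> Field \<kappa>. g \<alpha> = i}" for i
  have g_Field: "g \<alpha> \<in> Field \<kappa>" if "\<alpha> \<in> Field \<kappa>" for \<alpha>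
    using g that by (auto simp: Field_def)

  \<comment> \<open>The rounds of the game on \<open>X (sig B i)\<close> are the \<open>\<alpha>\<close> in the fibre \<open>E i\<close>. As \<open>g \<alpha> \<le> \<alpha>\<close>,
    the space of the game that is played in round \<open>\<alpha>\<close> is known by then.\<close>
  define game where "game \<sigma> i s \<longleftrightarrow>
    (\<forall>\<alpha>\<in>E i. \<forall>C\<in>underS \<kappa> \<alpha> \<inter> E i \<rightarrow>\<^sub>E nonempty_opens (X \<sigma>). s \<alpha> C \<in> nonempty_opens (X \<sigma>)) \<and>
    (\<forall>B. (\<forall>\<alpha>\<in>E i. B \<alpha> \<in> nonempty_opens (X \<sigma>) \<and> B \<alpha> \<subseteq> s \<alpha> (restrict B (underS \<kappa> \<alpha> \<inter> E i))) \<longrightarrow>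
       X \<sigma> closure_of (\<Union>\<alpha>\<in>E i. B \<alpha>) = topspace (X \<sigma>))" for \<sigma> i s
  \<comment> \<open>The choice depends on \<sigma> and \<open>i\<close> only, so all rounds in
    \<open>E i\<close> consult one strategy.\<close>
  define t where "t \<sigma> i = (SOME s. game \<sigma> i s)" for \<sigma> i
  have t: "game \<sigma> i (t \<sigma> i)" if "\<sigma> \<in> S" "i \<in> Field \<kappa>" for \<sigma> i
  proof -
    have "E i \<subseteq> Field \<kappa>" "|E i| =o \<kappa>"
      using g_fibre that(2) by (auto simp: E_def)
    then have "\<exists>s. game \<sigma> i s"
      unfolding game_def using favorable_Restr[OF card _ _ fav[OF that(1)] ne[OF that(1)]] by simp
    then show ?thesis
      unfolding t_def by (rule someI_ex)
  qed

  \<comment> \<open>Shrinking moves to basic open sets\<close>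
  define refines where "refines \<sigma> C \<tau>V \<longleftrightarrow> (case \<tau>V of (\<tau>, V) \<Rightarrow> \<tau> \<in> S \<and> le \<sigma> \<tau> \<and> openin (X \<tau>) V \<and>
    {x \<in> D. x \<tau> \<in> V} \<noteq> {} \<and> {x \<in> D. x \<tau> \<in> V} \<subseteq> C)" for \<sigma> C \<tau>V
  \<comment> \<open>\<open>nxt\<close> and \<open>base\<close> are the components of one choice, so
    that \<open>base \<sigma> C\<close> is open in \<open>X (nxt \<sigma> C)\<close> whenever a
    refinement exists.\<close>
  define nxt where "nxt \<sigma> C = fst (SOME \<tau>V. refines \<sigma> C \<tau>V)" for \<sigma> C
  define base where "base \<sigma> C = snd (SOME \<tau>V. refines \<sigma> C \<tau>V)" for \<sigma> C
  define core where "core \<sigma> C = {x \<in> D. x (nxt \<sigma> C) \<in> base \<sigma> C}" for \<sigma> C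
  have nxt: "nxt \<sigma> C \<in> S \<and> le \<sigma> (nxt \<sigma> C) \<and> openin (X (nxt \<sigma> C)) (base \<sigma> C) \<and>
      core \<sigma> C \<noteq> {} \<and> core \<sigma> C \<subseteq> C" if "\<sigma> \<in> S" "C \<in> nonempty_opens ?Y" for \<sigma> C
  proof -
    have "\<exists>\<tau>V. refines \<sigma> C \<tau>V"
      using refine_to_basic_open[OF inv D that] by (simp add: refines_def)
    then have "refines \<sigma> C (SOME \<tau>V. refines \<sigma> C \<tau>V)"
      by (rule someI_ex)
    then show ?thesis
      unfolding nxt_def base_def core_def refines_def[of \<sigma> C "SOME \<tau>V. refines \<sigma> C \<tau>V"]
      by (simp add: case_prod_beta)
  qed
  have core_open: "openin ?Y (core \<sigma> C)" if "\<sigma> \<in> S" "C \<in> nonempty_opens ?Y" for \<sigma> C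
  proof -
    have "openin ?Y {x \<in> topspace ?Y. x (nxt \<sigma> C) \<in> base \<sigma> C}"
      using nxt[OF that] by (intro openin_continuous_map_preimage[OF proj_cont]) auto
    then show ?thesis
      unfolding topY core_def .
  qed

  \<comment> \<open>The increasing indices along a play\<close>
  define ub where "ub A = (SOME \<tau>. \<tau> \<in> S \<and> (\<forall>\<rho>\<in>A. le \<rho> \<tau>))" for A
  \<comment> \<open>The empty chain occurs at the first round; any index serves there, while
    completeness handles non-empty chains.\<close>
  have ub: "ub A \<in> S \<and> (\<forall>\<rho>\<in>A. le \<rho> (ub A))"
    if "A \<subseteq> S" "Complete_Partial_Order.chain le A" "|A| \<le>o \<kappa>" for A
  proof -
    have "\<exists>\<tau>. \<tau> \<in> S \<and> (\<forall>\<rho>\<in>A. le \<rho> \<tau>)"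
    proof (cases "A = {}")
      case True
      then show ?thesis using dir by (auto simp: directed_set_def)
    next
      case False
      then show ?thesis
        using cds that unfolding complete_directed_set_def is_lub_in_def by blast
    qed
    then show ?thesis
      unfolding ub_def by (rule someI_ex)
  qed

  \<comment> \<open>The index of round \<alpha> bounds the indices to which all earlier moves were
    refined.\<close>
  obtain sig where sig_rec': "\<forall>C \<alpha>. sig C \<alpha> = (\<lambda>\<alpha> f c. ub ((\<lambda>\<beta>. nxt (f \<beta>) (c \<beta>)) ` underS \<kappa> \<alpha>))
      \<alpha> (restrict (sig C) (underS \<kappa> \<alpha>)) (restrict C (underS \<kappa> \<alpha>))"
    and sig_na: "nonanticipating \<kappa> sig"
    using nonanticipating_recursion[OF wo, of "\<lambda>\<alpha> f c. ub ((\<lambda>\<beta>. nxt (f \<beta>) (c \<beta>)) ` underS \<kappa> \<alpha>)"]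
    by (elim exE conjE)
  have sig_rec: "sig C \<alpha> = ub ((\<lambda>\<beta>. nxt (sig C \<beta>) (C \<beta>)) ` underS \<kappa> \<alpha>)" for C \<alpha>
    by (subst sig_rec'[rule_format]) simp
  \<comment> \<open>Membership and the bound go through one induction: the bounds at earlier rounds
    make the set in \<open>sig_rec\<close> a chain, to which \<open>ub\<close> applies.\<close>
  have sig: "sig C \<alpha> \<in> S \<and> (\<forall>\<beta>\<in>underS \<kappa> \<alpha>. le (nxt (sig C \<beta>) (C \<beta>)) (sig C \<alpha>))"
    if "\<forall>\<beta>\<in>underS \<kappa> \<alpha>. C \<beta> \<in> nonempty_opens ?Y" for C \<alpha>
    using that
  proof (induction \<alpha> rule: wf_induct_rule[OF wf])
    case (1 \<alpha>)
    let ?n = "\<lambda>\<beta>. nxt (sig C \<beta>) (C \<beta>)"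
    have IH: "sig C \<beta> \<in> S \<and> (\<forall>\<gamma>\<in>underS \<kappa> \<beta>. le (?n \<gamma>) (sig C \<beta>))" if \<beta>: "\<beta> \<in> underS \<kappa> \<alpha>" for \<beta>
    proof (rule "1.IH")
      show "(\<beta>, \<alpha>) \<in> \<kappa> - Id"
        using \<beta> by (simp add: underS_def)
      then show "\<forall>\<gamma>\<in>underS \<kappa> \<beta>. C \<gamma> \<in> nonempty_opens ?Y"
        using "1.prems" underS_trans by blast
    qed
    have n: "?n \<beta> \<in> S" "le (sig C \<beta>) (?n \<beta>)" if "\<beta> \<in> underS \<kappa> \<alpha>" for \<beta>
      using nxt IH[OF that] "1.prems" that by blast+
    have mono: "le (?n \<gamma>) (?n \<beta>)" if "\<gamma> \<in> underS \<kappa> \<beta>" "\<beta> \<in> underS \<kappa> \<alpha>" for \<beta> \<gamma>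
    proof -
      have \<gamma>: "\<gamma> \<in> underS \<kappa> \<alpha>"
        using underS_trans[OF that(1)] that(2) by (simp add: underS_def)
      show ?thesis
        using le_trans[of "?n \<gamma>" "sig C \<beta>" "?n \<beta>"] n[OF \<gamma>] n[OF that(2)] IH[OF that(2)] that(1) by blast
    qed
    have "Complete_Partial_Order.chain le (?n ` underS \<kappa> \<alpha>)"
      unfolding chain_def
    proof (intro ballI, elim imageE, clarify)
      fix \<beta> \<gamma> assume \<beta>\<gamma>: "\<beta> \<in> underS \<kappa> \<alpha>" "\<gamma> \<in> underS \<kappa> \<alpha>" "\<not> le (?n \<gamma>) (?n \<beta>)"
      then show "le (?n \<beta>) (?n \<gamma>)"
        using total[of \<beta> \<gamma>] underS_Field mono n(1) le_refl by blast
    qed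
    moreover have "|?n ` underS \<kappa> \<alpha>| \<le>o \<kappa>"
    proof -
      have "|underS \<kappa> \<alpha>| \<le>o |Field \<kappa>|"
        using underS_Field by (intro card_of_mono1) blast
      then show ?thesis
        using card_of_image card_of_Field_ordIso[OF card] ordLeq_transitive ordLeq_ordIso_trans by blast
    qed
    moreover have "?n ` underS \<kappa> \<alpha> \<subseteq> S"
      using n(1) by blast
    ultimately show ?case
      using ub[of "?n ` underS \<kappa> \<alpha>"] unfolding sig_rec[of C \<alpha>] by blast
  qed

  \<comment> \<open>The move \<open>C \<beta>\<close> of the opponent becomes a move in the game on \<open>X \<rho>\<close> by projecting a basic open
    subset of it. The default \<open>topspace (X \<rho>)\<close> is only reached in plays that violate the rules.\<close>
  define resp where "resp C W \<beta> = (let \<rho> = sig C (g \<beta>);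
      R = W \<inter> X \<rho> interior_of (X \<rho> closure_of ((\<lambda>x. x \<rho>) ` core (sig C \<beta>) (C \<beta>)))
      in if R \<in> nonempty_opens (X \<rho>) then R else topspace (X \<rho>))" for C W \<beta>
  \<comment> \<open>Only earlier rounds of the same fibre enter the history of the game consulted in
    round \<alpha>.\<close>
  define \<Phi> where "\<Phi> \<alpha> w c = t (sig c (g \<alpha>)) (g \<alpha>) \<alpha>
      (\<lambda>\<beta>\<in>underS \<kappa> \<alpha> \<inter> E (g \<alpha>). resp c (w \<beta>) \<beta>)" for \<alpha> w c
  obtain W where W_rec: "\<forall>C \<alpha>. W C \<alpha> = \<Phi> \<alpha> (restrict (W C) (underS \<kappa> \<alpha>)) (restrict C (underS \<kappa> \<alpha>))"
    and W_na: "nonanticipating \<kappa> W"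
    using nonanticipating_recursion[OF wo, of \<Phi>] by (elim exE conjE)
  \<comment> \<open>\<open>R C\<close> collects the opponent's moves in the simulated games;
    \<open>P\<close> is the strategy on \<open>D\<close>, the trace of the preimage of
    \<open>W C \<alpha>\<close>.\<close>
  define R where "R C \<beta> = resp C (W C \<beta>) \<beta>" for C \<beta>
  define P where "P C \<alpha> = {x \<in> D. x (sig C (g \<alpha>)) \<in> W C \<alpha>}" for C \<alpha>

  \<comment> \<open>The recursion for \<open>W\<close> is given only the moves before \<alpha>. The
    index of round \<alpha> itself is still correct, since it depends only on strictly earlier
    moves.\<close>
  have sig_restrict: "sig (restrict C (underS \<kappa> \<alpha>)) \<beta> = sig C \<beta>" if "(\<beta>, \<alpha>) \<in> \<kappa>" for C \<alpha> \<beta>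
  proof (rule nonanticipatingD[OF sig_na])
    show "\<beta> \<in> Field \<kappa>"
      using that by (auto simp: Field_def)
  qed (simp add: underS_trans[OF _ that])
  have W: "W C \<alpha> = t (sig C (g \<alpha>)) (g \<alpha>) \<alpha> (restrict (R C) (underS \<kappa> \<alpha> \<inter> E (g \<alpha>)))"
    if \<alpha>: "\<alpha> \<in> Field \<kappa>" for C \<alpha>
  proof -
    have "resp (restrict C (underS \<kappa> \<alpha>)) (restrict (W C) (underS \<kappa> \<alpha>) \<beta>) \<beta> = R C \<beta>"
      if \<beta>: "\<beta> \<in> underS \<kappa> \<alpha>" for \<beta>
    proof -
      have "(\<beta>, \<alpha>) \<in> \<kappa>" "(g \<beta>, \<beta>) \<in> \<kappa>"
        using \<beta> g underS_Field[OF \<beta>] by (auto simp: underS_def)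
      moreover from this have "(g \<beta>, \<alpha>) \<in> \<kappa>"
        using \<open>trans \<kappa>\<close> by (blast dest: transD)
      ultimately show ?thesis
        using \<beta> by (simp add: resp_def R_def sig_restrict)
    qed
    then have "(\<lambda>\<beta>\<in>underS \<kappa> \<alpha> \<inter> E (g \<alpha>).
        resp (restrict C (underS \<kappa> \<alpha>)) (restrict (W C) (underS \<kappa> \<alpha>) \<beta>) \<beta>) =
      restrict (R C) (underS \<kappa> \<alpha> \<inter> E (g \<alpha>))"
      by (intro restrict_ext) simp
    moreover have "sig (restrict C (underS \<kappa> \<alpha>)) (g \<alpha>) = sig C (g \<alpha>)"
      using g \<alpha> by (simp add: sig_restrict)
    ultimately show ?thesis
      by (subst W_rec[rule_format]) (simp only: \<Phi>_def)
  qed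

  \<comment> \<open>Only non-empty open moves are required, not obedience to the strategy, matching
    the legality condition of \<open>favorableI\<close>.\<close>
  define valid where "valid C \<alpha> \<longleftrightarrow> (\<forall>\<beta>\<in>underS \<kappa> \<alpha>. C \<beta> \<in> nonempty_opens ?Y)" for C \<alpha>
  have valid_mono: "valid C \<beta>" if "valid C \<alpha>" "(\<beta>, \<alpha>) \<in> \<kappa>" for C \<alpha> \<beta>
    using that underS_trans unfolding valid_def by blast
  have sig_S: "sig C \<alpha> \<in> S" if "valid C \<alpha>" for C \<alpha>
    using sig that unfolding valid_def by blast
  have sig_g_S: "sig C (g \<alpha>) \<in> S" if "\<alpha> \<in> Field \<kappa>" "valid C \<alpha>" for C \<alpha>
    using sig_S valid_mono g that by blast
  have R_open: "R C \<beta> \<in> nonempty_opens (X (sig C (g \<beta>)))" if "\<beta> \<in> Field \<kappa>" "valid C \<beta>" for C \<beta>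
    using ne[OF sig_g_S[OF that]] by (simp add: R_def resp_def Let_def nonempty_opens_def)
  have W_open: "W C \<alpha> \<in> nonempty_opens (X (sig C (g \<alpha>)))" if \<alpha>: "\<alpha> \<in> Field \<kappa>" "valid C \<alpha>" for C \<alpha>
  proof -
    have "R C \<beta> \<in> nonempty_opens (X (sig C (g \<alpha>)))" if \<beta>: "\<beta> \<in> underS \<kappa> \<alpha>" "\<beta> \<in> E (g \<alpha>)" for \<beta>
    proof -
      have "(\<beta>, \<alpha>) \<in> \<kappa>" "\<beta> \<in> Field \<kappa>" "g \<beta> = g \<alpha>"
        using \<beta> by (auto simp: underS_def E_def)
      then show ?thesis
        using R_open[of \<beta> C] valid_mono \<alpha>(2) by simp
    qed
    then have "restrict (R C) (underS \<kappa> \<alpha> \<inter> E (g \<alpha>)) \<in>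
        underS \<kappa> \<alpha> \<inter> E (g \<alpha>) \<rightarrow>\<^sub>E nonempty_opens (X (sig C (g \<alpha>)))"
      by simp
    moreover have "\<alpha> \<in> E (g \<alpha>)"
      using \<alpha> by (simp add: E_def)
    ultimately show ?thesis
      using t[OF sig_g_S[OF \<alpha>] g_Field[OF \<alpha>(1)]] unfolding W[OF \<alpha>(1)] game_def by blast
  qed

  \<comment> \<open>Verification of the strategy on \<open>D\<close>\<close>
  show ?thesis
  proof (rule favorableI[where P = P])
    show "nonanticipating \<kappa> P"
      unfolding nonanticipating_def
    proof (intro allI ballI impI)
      fix C C' :: "'k \<Rightarrow> ('s \<Rightarrow> 'a) set" and \<alpha>
      assume \<alpha>: "\<alpha> \<in> Field \<kappa>" and eq: "\<forall>\<beta>\<in>underS \<kappa> \<alpha>. C \<beta> = C' \<beta>"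
      have "W C \<alpha> = W C' \<alpha>"
        using W_na \<alpha> by (rule nonanticipatingD) (simp add: eq)
      moreover have "sig C (g \<alpha>) = sig C' (g \<alpha>)"
        using sig_na g_Field[OF \<alpha>]
        by (rule nonanticipatingD) (simp add: eq underS_trans[OF _ g[rule_format, OF \<alpha>]])
      ultimately show "P C \<alpha> = P C' \<alpha>"
        by (simp add: P_def)
    qed
  next
    fix \<alpha> C assume \<alpha>: "\<alpha> \<in> Field \<kappa>" and C: "\<And>\<beta>. \<beta> \<in> underS \<kappa> \<alpha> \<Longrightarrow> C \<beta> \<in> nonempty_opens ?Y"
    have valid: "valid C \<alpha>"
      using C by (simp add: valid_def)
    have \<rho>: "sig C (g \<alpha>) \<in> S"
      using sig_g_S[OF \<alpha> valid] .
    have Wo: "openin (X (sig C (g \<alpha>))) (W C \<alpha>)" "W C \<alpha> \<noteq> {}"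
      using W_open[OF \<alpha> valid] by (auto simp: nonempty_opens_def)
    have "openin ?Y {x \<in> topspace ?Y. x (sig C (g \<alpha>)) \<in> W C \<alpha>}"
      by (rule openin_continuous_map_preimage[OF proj_cont[OF \<rho>] Wo(1)])
    then have "openin ?Y (P C \<alpha>)"
      unfolding topY P_def .
    moreover have "W C \<alpha> \<inter> (\<lambda>x. x (sig C (g \<alpha>))) ` D \<noteq> {}"
    proof (rule meets[OF Wo(1)])
      show "W C \<alpha> \<inter> X (sig C (g \<alpha>)) closure_of (\<lambda>x. x (sig C (g \<alpha>))) ` D \<noteq> {}"
        using projection_image_dense[where X = X, OF surj[OF \<rho>] dense \<rho>] Wo openin_subset by fastforce
    qed
    then have "P C \<alpha> \<noteq> {}"
      by (auto simp: P_def)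
    ultimately show "P C \<alpha> \<in> nonempty_opens ?Y"
      by (simp add: nonempty_opens_def)
  next
    fix B assume B: "\<And>\<alpha>. \<alpha> \<in> Field \<kappa> \<Longrightarrow> B \<alpha> \<in> nonempty_opens ?Y \<and> B \<alpha> \<subseteq> P B \<alpha>"
    have valid: "valid B \<alpha>" for \<alpha>
      using B underS_Field by (auto simp: valid_def)
    have \<sigma>S: "sig B \<alpha> \<in> S" for \<alpha>
      using sig_S valid by blast
    have nxtB: "nxt (sig B \<alpha>) (B \<alpha>) \<in> S \<and> le (sig B \<alpha>) (nxt (sig B \<alpha>) (B \<alpha>)) \<and>
        openin (X (nxt (sig B \<alpha>) (B \<alpha>))) (base (sig B \<alpha>) (B \<alpha>)) \<and>
        core (sig B \<alpha>) (B \<alpha>) \<noteq> {} \<and> core (sig B \<alpha>) (B \<alpha>) \<subseteq> B \<alpha>" if "\<alpha> \<in> Field \<kappa>" for \<alpha>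
      using nxt[OF \<sigma>S] B[OF that] by blast
    have nxt_le: "le (nxt (sig B \<beta>) (B \<beta>)) (sig B \<alpha>)" if "\<beta> \<in> underS \<kappa> \<alpha>" for \<alpha> \<beta>
      using sig valid that unfolding valid_def by blast
    have sig_mono: "le (sig B \<beta>) (sig B \<alpha>)" if "\<beta> \<in> underS \<kappa> \<alpha>" for \<alpha> \<beta>
      using le_trans[OF _ nxt_le[OF that]] nxtB[OF underS_Field[OF that]] \<sigma>S by blast
    \<comment> \<open>In a play that obeys \<open>P\<close> the default of \<open>resp\<close> is
      not reached: the interior \<open>?Q\<close> meets the projected core, and the core projects
      into \<open>W B \<alpha>\<close> because it lies in \<open>P B \<alpha>\<close>.\<close>
    have R_sub: "R B \<alpha> \<subseteq> X (sig B (g \<alpha>)) closure_of ((\<lambda>x. x (sig B (g \<alpha>))) ` core (sig B \<alpha>) (B \<alpha>)) \<and>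
        R B \<alpha> \<subseteq> W B \<alpha>" if \<alpha>: "\<alpha> \<in> Field \<kappa>" for \<alpha>
    proof -
      let ?Z = "X (sig B (g \<alpha>))"
      let ?c = "(\<lambda>x. x (sig B (g \<alpha>))) ` core (sig B \<alpha>) (B \<alpha>)"
      let ?Q = "?Z interior_of (?Z closure_of ?c)"
      have "?Q \<noteq> {}"
        using int_ne[OF \<sigma>S core_open[OF \<sigma>S]] nxtB[OF \<alpha>] B[OF \<alpha>] by blast
      moreover have Q_sub: "?Q \<subseteq> ?Z closure_of ?c"
        by (rule interior_of_subset)
      ultimately have "?Q \<inter> ?c \<noteq> {}"
        using meets[OF openin_interior_of, of ?Z "?Z closure_of ?c" ?c] by blast
      moreover have "?c \<subseteq> W B \<alpha>"
        using nxtB[OF \<alpha>] B[OF \<alpha>] by (auto simp: P_def)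
      ultimately have "W B \<alpha> \<inter> ?Q \<noteq> {}"
        by blast
      moreover have "openin ?Z (W B \<alpha> \<inter> ?Q)"
        using W_open[OF \<alpha> valid] by (auto simp: nonempty_opens_def)
      ultimately have "W B \<alpha> \<inter> ?Q \<in> nonempty_opens ?Z"
        by (simp add: nonempty_opens_def)
      then have "R B \<alpha> = W B \<alpha> \<inter> ?Q"
        by (simp add: R_def resp_def Let_def)
      then show ?thesis
        using Q_sub by blast
    qed
    \<comment> \<open>The rounds in \<open>E i\<close> form a complete play against the winning
      strategy \<open>t (sig B i) i\<close>.\<close>
    have game_won: "X (sig B i) closure_of (\<Union>\<alpha>\<in>E i. R B \<alpha>) = topspace (X (sig B i))"
      if i: "i \<in> Field \<kappa>" for i
    proof -
      have "R B \<alpha> \<in> nonempty_opens (X (sig B i)) \<and>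
          R B \<alpha> \<subseteq> t (sig B i) i \<alpha> (restrict (R B) (underS \<kappa> \<alpha> \<inter> E i))" if "\<alpha> \<in> E i" for \<alpha>
      proof -
        have \<alpha>: "\<alpha> \<in> Field \<kappa>" "g \<alpha> = i"
          using that by (auto simp: E_def)
        show ?thesis
          using R_open[OF \<alpha>(1) valid] R_sub[OF \<alpha>(1)] W[OF \<alpha>(1), of B] \<alpha>(2) by simp
      qed
      then show ?thesis
        using t[OF \<sigma>S i] unfolding game_def by simp
    qed

    \<comment> \<open>The supremum of the chain of indices\<close>
    define A where "A = sig B ` Field \<kappa>"
    have AS: "A \<subseteq> S" "A \<noteq> {}"
      using \<sigma>S inf by (auto simp: A_def)
    have chain: "Complete_Partial_Order.chain le A"
      unfolding chain_def A_def
    proof (intro ballI, elim imageE, clarify)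
      fix \<beta> \<gamma> assume \<beta>\<gamma>: "\<beta> \<in> Field \<kappa>" "\<gamma> \<in> Field \<kappa>" "\<not> le (sig B \<gamma>) (sig B \<beta>)"
      then show "le (sig B \<beta>) (sig B \<gamma>)"
        using total[of \<beta> \<gamma>] sig_mono le_refl[OF \<sigma>S] by blast
    qed
    have cardA: "|A| \<le>o \<kappa>"
      unfolding A_def using card_of_image card_of_Field_ordIso[OF card] ordLeq_ordIso_trans by blast
    obtain \<tau> where lub: "is_lub_in S le A \<tau>"
      using cds AS chain cardA unfolding complete_directed_set_def by blast
    then have \<tau>: "\<tau> \<in> S" "\<And>\<alpha>. \<alpha> \<in> Field \<kappa> \<Longrightarrow> le (sig B \<alpha>) \<tau>"
      by (auto simp: is_lub_in_def A_def)
    \<comment> \<open>An infinite cardinal has no last element, so some later round has an index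
      above this one. Hence every shrunk move is determined by its projection to
      \<open>X \<tau>\<close>.\<close>
    have nxt_\<tau>: "le (nxt (sig B \<alpha>) (B \<alpha>)) \<tau>" if \<alpha>: "\<alpha> \<in> Field \<kappa>" for \<alpha>
    proof -
      obtain \<beta> where \<beta>: "\<beta> \<in> Field \<kappa>" "\<alpha> \<noteq> \<beta>" "(\<alpha>, \<beta>) \<in> \<kappa>"
        using infinite_Card_order_limit[OF card inf \<alpha>] by blast
      then have "le (nxt (sig B \<alpha>) (B \<alpha>)) (sig B \<beta>)"
        by (intro nxt_le) (simp add: underS_def)
      then show ?thesis
        using le_trans \<tau>(1) \<tau>(2)[OF \<beta>(1)] \<sigma>S nxtB[OF \<alpha>] by blast
    qed
    let ?h = "\<lambda>x. \<lambda>\<alpha>\<in>A. p \<tau> \<alpha> x"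
    let ?LA = "inverse_limit A le X p"
    have h: "homeomorphic_map (X \<tau>) ?LA ?h"
      using AS chain cardA lub by (rule hom)
    have invA: "inverse_system A le X p"
      using inv AS(1) directed_set_chain[OF dir AS chain] by (rule inverse_system_subset)

    \<comment> \<open>Density of the union of the moves\<close>
    have "(\<Union>\<alpha>\<in>Field \<kappa>. B \<alpha>) \<inter> U \<noteq> {}" if U: "openin ?Y U" "U \<noteq> {}" for U
    proof -
      let ?\<pi>U = "(\<lambda>x. x \<tau>) ` U"
      define Q where "Q = X \<tau> interior_of (X \<tau> closure_of ?\<pi>U)"
      have Q: "openin (X \<tau>) Q" "Q \<noteq> {}" "Q \<subseteq> X \<tau> closure_of ?\<pi>U"
        unfolding Q_def by (intro openin_interior_of int_ne[OF \<tau>(1) U] interior_of_subset)+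
      have hQ: "openin ?LA (?h ` Q)"
        using h Q(1) homeomorphic_imp_open_map unfolding open_map_def by blast
      obtain z where z: "z \<in> Q"
        using Q(2) by blast
      \<comment> \<open>Since \<open>X \<tau>\<close> is the limit along \<open>A\<close>, the basic
        set inside \<open>Q\<close> has an index in the chain, and a full game was won on the space
        of that index.\<close>
      obtain \<sigma> V where \<sigma>: "\<sigma> \<in> A" and V: "openin (X \<sigma>) V" "?h z \<sigma> \<in> V"
        "{y \<in> topspace ?LA. y \<sigma> \<in> V} \<subseteq> ?h ` Q"
        using inverse_limit_basis[OF invA hQ imageI[OF z]] by blast
      obtain i where i: "i \<in> Field \<kappa>" "\<sigma> = sig B i"
        using \<sigma> by (auto simp: A_def)
      have VQ: "w \<in> Q" if w: "w \<in> topspace (X \<tau>)" "p \<tau> \<sigma> w \<in> V" for w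
      proof -
        have "?h w \<in> topspace ?LA"
          using homeomorphic_imp_surjective_map[OF h] w(1) by blast
        then have "?h w \<in> ?h ` Q"
          using V(3) w(2) \<sigma> by auto
        then show ?thesis
          using homeomorphic_imp_injective_map[OF h] w(1) openin_subset[OF Q(1)]
          by (meson inj_on_image_mem_iff)
      qed
      have "V \<inter> (\<Union>\<alpha>\<in>E i. R B \<alpha>) \<noteq> {}"
      proof (rule meets[OF V(1)])
        show "V \<inter> X \<sigma> closure_of (\<Union>\<alpha>\<in>E i. R B \<alpha>) \<noteq> {}"
          using V(1,2) game_won[OF i(1)] openin_subset[OF V(1)] i(2) by auto
      qed
      then obtain \<alpha> where \<alpha>: "\<alpha> \<in> Field \<kappa>" "g \<alpha> = i" "V \<inter> R B \<alpha> \<noteq> {}"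
        by (auto simp: E_def)
      let ?C = "core (sig B \<alpha>) (B \<alpha>)"
      let ?\<upsilon> = "nxt (sig B \<alpha>) (B \<alpha>)"
      have "V \<inter> (\<lambda>x. x \<sigma>) ` ?C \<noteq> {}"
      proof (rule meets[OF V(1)])
        show "V \<inter> X \<sigma> closure_of (\<lambda>x. x \<sigma>) ` ?C \<noteq> {}"
          using R_sub[OF \<alpha>(1)] \<alpha>(2,3) i(2) by auto
      qed
      then obtain x where x: "x \<in> ?C" "x \<sigma> \<in> V"
        by blast
      have p: "y \<tau> \<in> topspace (X \<tau>) \<and> p \<tau> \<sigma> (y \<tau>) = y \<sigma> \<and> p \<tau> ?\<upsilon> (y \<tau>) = y ?\<upsilon>" if "y \<in> D" for y
        using subsetD[OF D that] \<tau>(1) \<tau>(2)[OF i(1)] i(2) \<sigma>S nxtB[OF \<alpha>(1)] nxt_\<tau>[OF \<alpha>(1)]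
        by (auto simp: topspace_inverse_limit)
      \<comment> \<open>An open subset of \<open>X \<tau>\<close> whose preimage in \<open>D\<close>
        is the core \<open>?C\<close>.\<close>
      define V' where "V' = {w \<in> topspace (X \<tau>). p \<tau> ?\<upsilon> w \<in> base (sig B \<alpha>) (B \<alpha>)}"
      have "continuous_map (X \<tau>) (X ?\<upsilon>) (p \<tau> ?\<upsilon>)"
        using inv \<tau>(1) nxtB[OF \<alpha>(1)] nxt_\<tau>[OF \<alpha>(1)] unfolding inverse_system_def by blast
      then have "openin (X \<tau>) (Q \<inter> V')"
        unfolding V'_def using nxtB[OF \<alpha>(1)] Q(1) by (intro openin_Int openin_continuous_map_preimage) auto
      moreover have "x \<tau> \<in> Q \<inter> V'"
        using x p[of x] VQ by (auto simp: V'_def core_def)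
      \<comment> \<open>The point \<open>x\<close> shows that this open set is non-empty; lying in
        the closure of the projection of \<open>U\<close>, it must meet the projection. This trades
        \<open>x\<close> for a point of \<open>U\<close> in the same core.\<close>
      ultimately have "Q \<inter> V' \<inter> ?\<pi>U \<noteq> {}"
        using Q(3) meets[of "X \<tau>" "Q \<inter> V'" "?\<pi>U"] by blast
      then obtain y where y: "y \<in> U" "y \<tau> \<in> V'"
        by blast
      then have "y \<in> D"
        using openin_subset[OF U(1)] topY by blast
      then have "y \<in> ?C"
        using y(2) p[of y] by (auto simp: V'_def core_def)
      then show ?thesis
        using nxtB[OF \<alpha>(1)] \<alpha>(1) y(1) by blast
    qed
    then show "?Y closure_of (\<Union>\<alpha>\<in>Field \<kappa>. B \<alpha>) = topspace ?Y"
      by (intro dense_intersects_open[THEN iffD2] allI impI) (elim conjE)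
  qed
qed

text \<open>The two inequalities come from simulating all games on \<open>D\<close> and from
  projecting a game on \<open>D\<close> to each \<open>X \<sigma>\<close>. Surjectivity of the limit
  projections is stated explicitly because, over general directed sets, surjective bonding maps do
  not guarantee it.\<close>

theorem theorem5:
  fixes \<kappa> :: "'k rel"
    and S :: "'s set" and le :: "'s \<Rightarrow> 's \<Rightarrow> bool"
    and X :: "'s \<Rightarrow> 'a topology" and p :: "'s \<Rightarrow> 's \<Rightarrow> 'a \<Rightarrow> 'a"
    and D :: "('s \<Rightarrow> 'a) set"
  assumes kappa: "is_card_Sup \<kappa> ((\<lambda>\<sigma>. mu (X \<sigma>)) ` S)"
    and complete: "complete_inverse_system \<kappa> S le X p"
    and projections: "\<And>\<sigma>. \<sigma> \<in> S \<Longrightarrow>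
          (\<lambda>x. x \<sigma>) ` topspace (inverse_limit S le X p) = topspace (X \<sigma>)"
    and skeletal: "\<And>\<sigma> \<rho>. \<sigma> \<in> S \<Longrightarrow> \<rho> \<in> S \<Longrightarrow> le \<rho> \<sigma> \<Longrightarrow> skeletal_map (X \<sigma>) (X \<rho>) (p \<sigma> \<rho>)"
    and subset: "D \<subseteq> topspace (inverse_limit S le X p)"
    and dense: "inverse_limit S le X p closure_of D = topspace (inverse_limit S le X p)"
  shows "mu (subtopology (inverse_limit S le X p) D) =o \<kappa>"
proof -
  let ?L = "inverse_limit S le X p"
  let ?Y = "subtopology ?L D"
  have inv: "inverse_system S le X p"
    using complete by (simp add: complete_inverse_system_def)
  have ne: "topspace (X \<sigma>) \<noteq> {}" if "\<sigma> \<in> S" for \<sigma>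
    using inv that by (simp add: inverse_system_def)
  obtain \<sigma>\<^sub>0 where \<sigma>\<^sub>0: "\<sigma>\<^sub>0 \<in> S"
    using inv by (auto simp: inverse_system_def directed_set_def)
  have "D \<noteq> {}"
    using dense projections[OF \<sigma>\<^sub>0] ne[OF \<sigma>\<^sub>0] by (metis closure_of_empty image_empty)
  then have neY: "topspace ?Y \<noteq> {}"
    using subset by auto
  have card: "Card_order \<kappa>" and upper: "\<And>\<sigma>. \<sigma> \<in> S \<Longrightarrow> mu (X \<sigma>) \<le>o \<kappa>"
    using kappa by (auto simp: is_card_Sup_def)
  \<comment> \<open>\<kappa> is infinite because it bounds the infinite cardinal of at least one
    space.\<close>
  have \<kappa>: "Cinfinite \<kappa>"
    using cinfinite_mono[OF upper[OF \<sigma>\<^sub>0]] Cinfinite_mu[OF ne[OF \<sigma>\<^sub>0]] card by blast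
  have "favorable \<kappa> (X \<sigma>)" if "\<sigma> \<in> S" for \<sigma>
    using favorable_mono[OF upper[OF that] favorable_mu[OF ne[OF that]] ne[OF that]] .
  then have "favorable \<kappa> ?Y"
    by (intro favorable_dense_in_limit[OF \<kappa> complete projections skeletal subset dense])
  then have le: "mu ?Y \<le>o \<kappa>"
    by (rule mu_le[OF neY \<kappa>])
  have mu_Y: "Cinfinite (mu ?Y)"
    using neY by (rule Cinfinite_mu)
  then have wo: "Well_order (mu ?Y)"
    by (simp add: card_order_on_def)
  have mu_X: "mu (X \<sigma>) \<le>o mu ?Y" if \<sigma>: "\<sigma> \<in> S" for \<sigma>
  proof (rule mu_le[OF ne[OF \<sigma>] mu_Y])
    have "topspace ?Y = D"
      using subset by auto
    then show "favorable (mu ?Y) (X \<sigma>)"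
      using interior_closure_projection_nonempty[OF inv projections skeletal dense \<sigma>]
        projection_image_dense[where X = X, OF projections[OF \<sigma>] dense \<sigma>]
        continuous_map_from_subtopology[OF continuous_map_inverse_limit_projection[OF \<sigma>], of le X p D]
      by (intro favorable_dense_image[OF wo favorable_mu[OF neY] neY]) simp_all
  qed
  \<comment> \<open>\<open>is_card_Sup\<close> compares \<kappa> with bounds on its own type only;
    the bound \<open>mu ?Y\<close>, being at most \<kappa>, has a copy there.\<close>
  obtain q :: "'k rel" where q: "Card_order q" "q =o mu ?Y"
    using Card_order_representative le mu_Y by blast
  have "mu (X \<sigma>) \<le>o q" if "\<sigma> \<in> S" for \<sigma>
    using mu_X[OF that] ordIso_symmetric[OF q(2)] by (rule ordLeq_ordIso_trans)
  then have "\<kappa> \<le>o q"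
    using kappa q(1) by (simp add: is_card_Sup_def)
  then have "\<kappa> \<le>o mu ?Y"
    using q(2) by (rule ordLeq_ordIso_trans)
  with le show ?thesis
    by (simp add: ordIso_iff_ordLeq)
qed

end
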